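(* Let $\gamma$ be a curve in the simply isotropic plane $\mathbb{I}^2$. Then $\gamma$ is an isotropic catenary with respect to $L_z$ if, and only if, its simply isotropic curvature $\kappa$ satisfies $$\kappa=\frac{\langle\mathbf{N}_{par},X\rangle}{\langle\gamma,X\rangle-\lambda},$$ where $X=\partial_x$.
   Context: The simply isotropic plane $\mathbb{I}^2$ is $\mathbb{R}^2$ with coordinates $(x,z)$ and the degenerate metric $\langle \mathbf u,\mathbf v\rangle=u^1v^1$, where $\mathbf u=(u^1,u^3)$, $\mathbf v=(v^1,v^3)$. $L_z=\{(0,z):z\in\mathbb{R}\}$ is the $z$-axis, and $X=\partial_x=(1,0)$ is the unit vector field orthogonal to $L_z$. Curves are smooth, admissible ($\dot x\neq0$; one may assume $\dot x>0$) and contained in the half-plane $x>0$. For a curve $\gamma(t)=(x(t),z(t))$ with $\dot x>0$, the simply isotropic curvature is $\kappa=\frac{\dot x\ddot z-\ddot x\dot z}{\dot x^3}$ and the parabolic normal is $\mathbf{N}_{par}=\left(-\frac{\dot z}{\dot x},\frac12-\frac{\dot z^2}{2\dot x^2}\right)$. The constant $\lambda\in\mathbb{R}$ is a fixed Lagrange multiplier, and an isotropic catenary with respect to $L_z$ is a curve $\gamma(t)=(t,c\ln(t-\lambda)+d)$ with $c,d\in\mathbb{R}$, $c\neq0$.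
   Formalization: The curve is assumed to lie in x > λ and not to be a horizontal segment (z not constant): horizontal segments and the curves (t, c ln(λ−t)+d) satisfy the curvature equation but are not catenaries; catenaries are taken up to regular reparametrization. *)

theory Defs
  imports "HOL-Analysis.Analysis"
begin

text \<open>
  Points and tangent vectors of the simply isotropic plane are pairs \<open>(x, z) :: real \<times> real\<close>.
  Curves are functions \<open>real \<Rightarrow> real \<times> real\<close> of which only the restriction to a nonempty open
  interval \<open>I\<close> matters.
\<close>

definition iso_metric :: "real \<times> real \<Rightarrow> real \<times> real \<Rightarrow> real" where
  "iso_metric u v = fst u * fst v"

definition X_field :: "real \<times> real" where
  "X_field = (1, 0)"

abbreviation x_coord :: "(real \<Rightarrow> real \<times> real) \<Rightarrow> real \<Rightarrow> real" where
  "x_coord \<gamma> \<equiv> (\<lambda>t. fst (\<gamma> t))"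

abbreviation z_coord :: "(real \<Rightarrow> real \<times> real) \<Rightarrow> real \<Rightarrow> real" where
  "z_coord \<gamma> \<equiv> (\<lambda>t. snd (\<gamma> t))"

text \<open>Infinite differentiability; meant for open \<open>I\<close>, where \<^const>\<open>deriv\<close> is the derivative along \<open>I\<close>.\<close>

definition smooth_fun_on :: "real set \<Rightarrow> (real \<Rightarrow> real) \<Rightarrow> bool" where
  "smooth_fun_on I f \<longleftrightarrow> (\<forall>n. (deriv ^^ n) f differentiable_on I)"

definition admissible_curve :: "real set \<Rightarrow> (real \<Rightarrow> real \<times> real) \<Rightarrow> bool" where
  "admissible_curve I \<gamma> \<longleftrightarrow>
     open I \<and> is_interval I \<and> I \<noteq> {} \<and>
     smooth_fun_on I (x_coord \<gamma>) \<and> smooth_fun_on I (z_coord \<gamma>) \<and>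
     (\<forall>t\<in>I. deriv (x_coord \<gamma>) t \<noteq> 0)"

text \<open>
  The two quantities below do not change under \<open>t \<mapsto> - t\<close>, so the formulas valid for
  \<open>x' > 0\<close> are the right ones for every admissible curve.
\<close>

definition iso_curvature :: "(real \<Rightarrow> real \<times> real) \<Rightarrow> real \<Rightarrow> real" where
  "iso_curvature \<gamma> t =
     (deriv (x_coord \<gamma>) t * deriv (deriv (z_coord \<gamma>)) t
        - deriv (deriv (x_coord \<gamma>)) t * deriv (z_coord \<gamma>) t)
     / (deriv (x_coord \<gamma>) t) ^ 3"

definition parabolic_normal :: "(real \<Rightarrow> real \<times> real) \<Rightarrow> real \<Rightarrow> real \<times> real" where
  "parabolic_normal \<gamma> t =
     (- (deriv (z_coord \<gamma>) t / deriv (x_coord \<gamma>) t),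
      1 / 2 - (deriv (z_coord \<gamma>) t)\<^sup>2 / (2 * (deriv (x_coord \<gamma>) t)\<^sup>2))"

definition catenary_param :: "real \<Rightarrow> real \<Rightarrow> real \<Rightarrow> real \<Rightarrow> real \<times> real" where
  "catenary_param lam c d s = (s, c * ln (s - lam) + d)"

text \<open>
  Being a catenary is a property of the geometric curve: \<open>\<gamma>\<close> is, up to a regular change of
  parameter \<open>\<phi>\<close>, an arc of \<open>s \<mapsto> (s, c ln (s - lam) + d)\<close>. The condition \<open>lam < \<phi> t\<close> keeps
  the arc in the domain of the logarithm, as \<^const>\<open>ln\<close> is total.
\<close>

definition isotropic_catenary_Lz :: "real \<Rightarrow> real set \<Rightarrow> (real \<Rightarrow> real \<times> real) \<Rightarrow> bool" where
  "isotropic_catenary_Lz lam I \<gamma> \<longleftrightarrow>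
     (\<exists>c d \<phi>. c \<noteq> 0 \<and> smooth_fun_on I \<phi> \<and> (\<forall>t\<in>I. deriv \<phi> t \<noteq> 0) \<and>
        (\<forall>t\<in>I. lam < \<phi> t \<and> \<gamma> t = catenary_param lam c d (\<phi> t)))"

end

theory Submission
  imports Defs
begin

text \<open>
  The function \<open>W = (x - lam) z' / x'\<close> is a first integral: \<open>W' = x' ((x - lam) \<kappa> + z' / x')\<close>,
  so the curvature equation says exactly that \<open>W\<close> is constant. On the other hand \<open>W = c\<close> means
  that \<open>z - c ln (x - lam)\<close> has derivative zero.
\<close>

text \<open>Since \<open>I\<close> is open, differentiability within \<open>I\<close> is
  differentiability at the point. Orders 0 and 1 suffice, as the curvature involves derivatives up
  to the second.\<close>

lemma smooth_fun_on_has_deriv: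
  assumes "smooth_fun_on I f" "open I" "t \<in> I"
  shows "(f has_real_derivative deriv f t) (at t)"
    and "(deriv f has_real_derivative deriv (deriv f) t) (at t)"
proof -
  have "(deriv ^^ n) f differentiable at t" for n
    using assms by (metis smooth_fun_on_def differentiable_on_def at_within_open)
  from this[of 0] this[of 1] show "(f has_real_derivative deriv f t) (at t)"
    "(deriv f has_real_derivative deriv (deriv f) t) (at t)"
    by (auto simp: DERIV_deriv_iff_real_differentiable)
qed

text \<open>The quotient \<open>z' / x'\<close> is the slope dz/dx, so the value at a point of the
  curve does not depend on the parametrization.\<close>

definition first_integral :: "real \<Rightarrow> (real \<Rightarrow> real \<times> real) \<Rightarrow> real \<Rightarrow> real" where
  "first_integral lam \<gamma> t = (x_coord \<gamma> t - lam) * deriv (z_coord \<gamma>) t / deriv (x_coord \<gamma>) t"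

text \<open>By the quotient rule the slope \<open>z' / x'\<close> has derivative
  \<open>x' * \<kappa>\<close>; the product rule with the factor \<open>x - lam\<close> gives the
  rest.\<close>

lemma first_integral_has_deriv:
  assumes "admissible_curve I \<gamma>" "t \<in> I"
  shows "(first_integral lam \<gamma> has_real_derivative
    deriv (x_coord \<gamma>) t * ((x_coord \<gamma> t - lam) * iso_curvature \<gamma> t
      + deriv (z_coord \<gamma>) t / deriv (x_coord \<gamma>) t)) (at t)"
proof -
  have I: "open I" "smooth_fun_on I (x_coord \<gamma>)" "smooth_fun_on I (z_coord \<gamma>)"
    and nz: "deriv (x_coord \<gamma>) t \<noteq> 0"
    using assms by (auto simp: admissible_curve_def)
  note [derivative_intros] = smooth_fun_on_has_deriv[OF I(2,1) assms(2)]
    smooth_fun_on_has_deriv[OF I(3,1) assms(2)]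
  show ?thesis
    unfolding first_integral_def[abs_def] iso_curvature_def using nz
    by (auto intro!: derivative_eq_intros simp: field_simps power2_eq_square power3_eq_cube)
qed

text \<open>Pairing with \<open>X_field\<close> picks out first coordinates, so the right-hand side
  is the negative slope over \<open>x - lam\<close>. As \<open>x'\<close> and \<open>x - lam\<close>
  do not vanish, the equation is equivalent to the vanishing of the derivative just
  computed.\<close>

lemma curvature_equation_iff:
  assumes "admissible_curve I \<gamma>" "t \<in> I" "lam < x_coord \<gamma> t"
  shows "iso_curvature \<gamma> t =
       iso_metric (parabolic_normal \<gamma> t) X_field / (iso_metric (\<gamma> t) X_field - lam)
    \<longleftrightarrow> (first_integral lam \<gamma> has_real_derivative 0) (at t)"
proof -
  have nz: "deriv (x_coord \<gamma>) t \<noteq> 0"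
    using assms by (auto simp: admissible_curve_def)
  have "(first_integral lam \<gamma> has_real_derivative 0) (at t) \<longleftrightarrow>
      (x_coord \<gamma> t - lam) * iso_curvature \<gamma> t + deriv (z_coord \<gamma>) t / deriv (x_coord \<gamma>) t = 0"
    using first_integral_has_deriv[OF assms(1,2), of lam] nz
    by (metis DERIV_unique mult_eq_0_iff)
  also have "\<dots> \<longleftrightarrow> iso_curvature \<gamma> t =
      - (deriv (z_coord \<gamma>) t / deriv (x_coord \<gamma>) t) / (x_coord \<gamma> t - lam)"
    using assms(3) nz by (simp add: divide_simps) (auto simp: algebra_simps)
  finally show ?thesis
    by (simp add: iso_metric_def parabolic_normal_def X_field_def)
qed

lemma zero_deriv_imp_constant:
  fixes f :: "real \<Rightarrow> real"
  assumes "is_interval I" "\<And>t. t \<in> I \<Longrightarrow> (f has_real_derivative 0) (at t)"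
  obtains c where "\<And>t. t \<in> I \<Longrightarrow> f t = c"
proof -
  have "\<exists>c. \<forall>t\<in>I. f t = c"
    using assms
    by (intro has_field_derivative_zero_constant)
       (auto intro: is_interval_convex has_field_derivative_at_within)
  then show thesis using that by blast
qed

text \<open>Serves both directions: it yields the slope of a given catenary, and it is compared with
  \<open>z'\<close> when the curve is reconstructed.\<close>

lemma log_graph_has_deriv:
  assumes "admissible_curve I \<gamma>" "t \<in> I" "lam < x_coord \<gamma> t"
  shows "((\<lambda>t. c * ln (x_coord \<gamma> t - lam) + d) has_real_derivative
    c * deriv (x_coord \<gamma>) t / (x_coord \<gamma> t - lam)) (at t)"
proof -
  have I: "open I" "smooth_fun_on I (x_coord \<gamma>)"
    using assms by (auto simp: admissible_curve_def)
  note [derivative_intros] = smooth_fun_on_has_deriv(1)[OF I(2,1) assms(2)]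
  show ?thesis
    using assms(3) by (auto intro!: derivative_eq_intros)
qed

theorem theorem2:
  fixes \<gamma> :: "real \<Rightarrow> real \<times> real" and I :: "real set" and lam :: real
  assumes "admissible_curve I \<gamma>"
    and "\<And>t. t \<in> I \<Longrightarrow> 0 < x_coord \<gamma> t"
    and "\<And>t. t \<in> I \<Longrightarrow> lam < x_coord \<gamma> t"
    and "\<not> z_coord \<gamma> constant_on I"
  shows "isotropic_catenary_Lz lam I \<gamma> \<longleftrightarrow>
    (\<forall>t\<in>I. iso_curvature \<gamma> t =
       iso_metric (parabolic_normal \<gamma> t) X_field / (iso_metric (\<gamma> t) X_field - lam))"
proof -
  let ?W = "first_integral lam \<gamma>"
  have I: "open I" "is_interval I" "smooth_fun_on I (x_coord \<gamma>)" "smooth_fun_on I (z_coord \<gamma>)"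
    and nz: "\<And>t. t \<in> I \<Longrightarrow> deriv (x_coord \<gamma>) t \<noteq> 0"
    using assms(1) by (auto simp: admissible_curve_def)
  have "isotropic_catenary_Lz lam I \<gamma> \<longleftrightarrow> (\<forall>t\<in>I. (?W has_real_derivative 0) (at t))"
  proof
    assume "isotropic_catenary_Lz lam I \<gamma>"
    then obtain c d \<phi> where "\<forall>t\<in>I. \<gamma> t = catenary_param lam c d (\<phi> t)"
      unfolding isotropic_catenary_Lz_def by blast
    \<comment> \<open>The first coordinate of \<open>catenary_param\<close> is its parameter, so
      \<open>\<phi>\<close> must agree with the x-coordinate on \<open>I\<close>.\<close>
    then have z: "z_coord \<gamma> t = c * ln (x_coord \<gamma> t - lam) + d" if "t \<in> I" for t
      using that by (simp add: catenary_param_def)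
    have "?W t = c" if t: "t \<in> I" for t
    proof -
      have "(z_coord \<gamma> has_real_derivative
          c * deriv (x_coord \<gamma>) t / (x_coord \<gamma> t - lam)) (at t)"
        using log_graph_has_deriv[OF assms(1) t assms(3)[OF t]] I(1) t
        by (rule has_field_derivative_transform_within_open) (simp add: z)
      then show ?thesis
        using nz[OF t] assms(3)[OF t] by (simp add: first_integral_def DERIV_imp_deriv)
    qed
    \<comment> \<open>\<open>I\<close> is open, so near each of its points \<open>?W\<close>
      coincides with the constant function \<open>c\<close>.\<close>
    then show "\<forall>t\<in>I. (?W has_real_derivative 0) (at t)"
      by (auto intro: has_field_derivative_transform_within_open[OF DERIV_const I(1)])
  next
    assume "\<forall>t\<in>I. (?W has_real_derivative 0) (at t)"
    then obtain c where c: "\<And>t. t \<in> I \<Longrightarrow> ?W t = c"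
      using zero_deriv_imp_constant[OF I(2)] by blast
    have "((\<lambda>t. z_coord \<gamma> t - c * ln (x_coord \<gamma> t - lam)) has_real_derivative 0) (at t)"
      if t: "t \<in> I" for t
    proof -
      \<comment> \<open>This is \<open>?W t = c\<close> solved for \<open>z'\<close>.\<close>
      have "deriv (z_coord \<gamma>) t - c * deriv (x_coord \<gamma>) t / (x_coord \<gamma> t - lam) = 0"
        using c[OF t] nz[OF t] assms(3)[OF t] by (auto simp: first_integral_def field_simps)
      then show ?thesis
        using DERIV_diff[OF smooth_fun_on_has_deriv(1)[OF I(4,1) t]
            log_graph_has_deriv[OF assms(1) t assms(3)[OF t], of c 0]] by simp
    qed
    then obtain d where "\<And>t. t \<in> I \<Longrightarrow> z_coord \<gamma> t - c * ln (x_coord \<gamma> t - lam) = d"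
      using zero_deriv_imp_constant[OF I(2)] by blast
    then have z: "z_coord \<gamma> t = c * ln (x_coord \<gamma> t - lam) + d" if "t \<in> I" for t
      using that by (simp add: algebra_simps)
    \<comment> \<open>For \<open>c = 0\<close> the curve would be a horizontal segment. Such
      segments satisfy the curvature equation with both sides zero, and nonconstancy of
      \<open>z\<close> excludes them.\<close>
    then have "c \<noteq> 0"
      using assms(4) by (auto simp: constant_on_def)
    \<comment> \<open>The change of parameter is the x-coordinate itself, smooth with nonzero
      derivative by admissibility.\<close>
    moreover have "\<gamma> t = catenary_param lam c d (x_coord \<gamma> t)" if "t \<in> I" for t
      using z[OF that] by (simp add: catenary_param_def prod_eq_iff)
    ultimately show "isotropic_catenary_Lz lam I \<gamma>"
      unfolding isotropic_catenary_Lz_def using I(3) nz assms(3) by blast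
  qed
  then show ?thesis
    using curvature_equation_iff[OF assms(1) _ assms(3)] by simp
qed

end
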